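(* Let $\mathfrak h$ and $\mathfrak g$ be topological Lie algebras, $V$ a topological $\mathfrak h$-module, $\omega\in Z^2(\mathfrak h,V)$ a continuous $2$-cocycle, $\zeta:\mathfrak g\to\mathrm{ham}(\mathfrak h,\omega)$ a continuous homomorphism of Lie algebras, and $J:\mathfrak g\to V_\omega$ a momentum map for $\zeta$. If $\xi\in\mathrm{ham}(\mathfrak h,\omega)$ satisfies $i_\xi\omega=d_{\mathfrak h}v$ for some $v\in V^{\mathfrak g}$, then $\xi.J(X)=0$ holds for all $X\in\mathfrak g$.
   Context: Cochains are continuous Chevalley–Eilenberg cochains with differential $d_{\mathfrak h}$; $(d_{\mathfrak h}v)(\xi)=\xi.v$; $i_\xi$ is insertion in the first argument. Since $\omega$ is a cocycle, $\mathrm{ham}(\mathfrak h,\omega)=\{\xi\in\mathfrak h:(\exists v\in V)\ i_\xi\omega=d_{\mathfrak h}v\}$. $V_\omega=\{v\in V:(\exists\xi\in\mathrm{ham}(\mathfrak h,\omega))\ d_{\mathfrak h}v=i_\xi\omega\}$. $\mathfrak g$ acts on $V$ by $X.v=\zeta(X).v$, and $V^{\mathfrak g}=\{v\in V:(\forall X\in\mathfrak g)\ X.v=0\}$. A momentum map for $\zeta$ is a continuous linear map $J:\mathfrak g\to V_\omega$ with $d_{\mathfrak h}(J(X))=i_{\zeta(X)}\omega$ for all $X\in\mathfrak g$. *)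

theory Defs
  imports "HOL-Analysis.Analysis"
begin

(* A commutative field in class real_normed_field is isomorphic to the reals or the complex
   numbers, so the type variable 'k stands for the ground field R or C.  No separation axiom or
   local convexity is required. *)

locale topological_vector_space = vector_space scale
  for scale :: "'k::real_normed_field \<Rightarrow> 'a::topological_ab_group_add \<Rightarrow> 'a" +
  assumes continuous_scale: "continuous_on UNIV (\<lambda>(c, x). scale c x)"

locale topological_lie_algebra = topological_vector_space scale
  for scale :: "'k::real_normed_field \<Rightarrow> 'a::topological_ab_group_add \<Rightarrow> 'a" +
  fixes bracket :: "'a \<Rightarrow> 'a \<Rightarrow> 'a"
  assumes linear_bracket_left: "\<And>y. Vector_Spaces.linear scale scale (\<lambda>x. bracket x y)"
    and linear_bracket_right: "\<And>x. Vector_Spaces.linear scale scale (\<lambda>y. bracket x y)"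
    and bracket_self: "\<And>x. bracket x x = 0"
    and jacobi: "\<And>x y z. bracket x (bracket y z) + bracket y (bracket z x)
                   + bracket z (bracket x y) = 0"
    and continuous_bracket: "continuous_on UNIV (\<lambda>(x, y). bracket x y)"

locale topological_lie_module =
  lie: topological_lie_algebra scale_h bracket + space: topological_vector_space scale_v
  for scale_h :: "'k::real_normed_field \<Rightarrow> 'h::topological_ab_group_add \<Rightarrow> 'h"
    and bracket :: "'h \<Rightarrow> 'h \<Rightarrow> 'h"
    and scale_v :: "'k \<Rightarrow> 'v::topological_ab_group_add \<Rightarrow> 'v" +
  fixes act :: "'h \<Rightarrow> 'v \<Rightarrow> 'v"
  assumes linear_act_left: "\<And>v. Vector_Spaces.linear scale_h scale_v (\<lambda>\<xi>. act \<xi> v)"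
    and linear_act_right: "\<And>\<xi>. Vector_Spaces.linear scale_v scale_v (\<lambda>v. act \<xi> v)"
    and act_bracket: "\<And>\<xi> \<eta> v. act (bracket \<xi> \<eta>) v = act \<xi> (act \<eta> v) - act \<eta> (act \<xi> v)"
    and continuous_act: "continuous_on UNIV (\<lambda>(\<xi>, v). act \<xi> v)"

definition continuous_lie_hom ::
  "('k::real_normed_field \<Rightarrow> 'g::topological_ab_group_add \<Rightarrow> 'g) \<Rightarrow> ('g \<Rightarrow> 'g \<Rightarrow> 'g) \<Rightarrow>
   ('k \<Rightarrow> 'h::topological_ab_group_add \<Rightarrow> 'h) \<Rightarrow> ('h \<Rightarrow> 'h \<Rightarrow> 'h) \<Rightarrow> ('g \<Rightarrow> 'h) \<Rightarrow> bool"
  where "continuous_lie_hom scale_g bracket_g scale_h bracket_h \<zeta> \<longleftrightarrow>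
    Vector_Spaces.linear scale_g scale_h \<zeta> \<and>
    (\<forall>X Y. \<zeta> (bracket_g X Y) = bracket_h (\<zeta> X) (\<zeta> Y)) \<and>
    continuous_on UNIV \<zeta>"

(* A p-cochain is a function on argument lists, extended by 0 to lists of length other than p
   so that equality of p-cochains is equality of functions. Continuity refers to the product
   topology on the p-fold power of the Lie algebra. *)
definition ce_cochains ::
  "('k::real_normed_field \<Rightarrow> 'h::topological_ab_group_add \<Rightarrow> 'h) \<Rightarrow>
   ('k \<Rightarrow> 'v::topological_ab_group_add \<Rightarrow> 'v) \<Rightarrow> nat \<Rightarrow> ('h list \<Rightarrow> 'v) set"
  where "ce_cochains scale_h scale_v p = {\<omega>.
    (\<forall>xs. length xs \<noteq> p \<longrightarrow> \<omega> xs = 0) \<and>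
    (\<forall>xs i. length xs = p \<and> i < p \<longrightarrow>
       Vector_Spaces.linear scale_h scale_v (\<lambda>\<xi>. \<omega> (xs[i := \<xi>]))) \<and>
    (\<forall>xs. length xs = p \<and> \<not> distinct xs \<longrightarrow> \<omega> xs = 0) \<and>
    continuous_map (product_topology (\<lambda>_. euclidean) {..<p}) euclidean
      (\<lambda>x. \<omega> (map x [0..<p]))}"

definition delete_nth :: "nat \<Rightarrow> 'a list \<Rightarrow> 'a list"
  where "delete_nth i xs = take i xs @ drop (Suc i) xs"

(* The degree is read off the length of the argument list: for a p-cochain both sums
   vanish unless that length is p + 1. In the second sum the larger index is deleted first,
   so that the smaller one keeps its meaning. *)
definition ce_diff ::
  "('h \<Rightarrow> 'h \<Rightarrow> 'h) \<Rightarrow> ('k::real_normed_field \<Rightarrow> 'v::ab_group_add \<Rightarrow> 'v) \<Rightarrow>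
   ('h \<Rightarrow> 'v \<Rightarrow> 'v) \<Rightarrow> ('h list \<Rightarrow> 'v) \<Rightarrow> 'h list \<Rightarrow> 'v"
  where "ce_diff bracket scale_v act \<omega> xs =
    (\<Sum>j<length xs. scale_v ((-1) ^ j) (act (xs ! j) (\<omega> (delete_nth j xs)))) +
    (\<Sum>j<length xs. \<Sum>i<j. scale_v ((-1) ^ (i + j))
       (\<omega> (bracket (xs ! i) (xs ! j) # delete_nth i (delete_nth j xs))))"

definition ce_cocycles ::
  "('k::real_normed_field \<Rightarrow> 'h::topological_ab_group_add \<Rightarrow> 'h) \<Rightarrow> ('h \<Rightarrow> 'h \<Rightarrow> 'h) \<Rightarrow>
   ('k \<Rightarrow> 'v::topological_ab_group_add \<Rightarrow> 'v) \<Rightarrow> ('h \<Rightarrow> 'v \<Rightarrow> 'v) \<Rightarrow> nat \<Rightarrow> ('h list \<Rightarrow> 'v) set"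
  where "ce_cocycles scale_h bracket scale_v act p =
    {\<omega> \<in> ce_cochains scale_h scale_v p. ce_diff bracket scale_v act \<omega> = (\<lambda>_. 0)}"

(* The identification of V with the space of 0-cochains. *)
definition cochain0 :: "'v::zero \<Rightarrow> 'h list \<Rightarrow> 'v"
  where "cochain0 v xs = (if xs = [] then v else 0)"

definition insertion :: "'h \<Rightarrow> ('h list \<Rightarrow> 'v) \<Rightarrow> 'h list \<Rightarrow> 'v"
  where "insertion \<xi> \<omega> = (\<lambda>xs. \<omega> (\<xi> # xs))"

definition ham ::
  "('h \<Rightarrow> 'h \<Rightarrow> 'h) \<Rightarrow> ('k::real_normed_field \<Rightarrow> 'v::ab_group_add \<Rightarrow> 'v) \<Rightarrow>
   ('h \<Rightarrow> 'v \<Rightarrow> 'v) \<Rightarrow> ('h list \<Rightarrow> 'v) \<Rightarrow> 'h set"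
  where "ham bracket scale_v act \<omega> =
    {\<xi>. \<exists>v. insertion \<xi> \<omega> = ce_diff bracket scale_v act (cochain0 v)}"

(* The space V_omega of admissible elements of V. *)
definition admissible ::
  "('h \<Rightarrow> 'h \<Rightarrow> 'h) \<Rightarrow> ('k::real_normed_field \<Rightarrow> 'v::ab_group_add \<Rightarrow> 'v) \<Rightarrow>
   ('h \<Rightarrow> 'v \<Rightarrow> 'v) \<Rightarrow> ('h list \<Rightarrow> 'v) \<Rightarrow> 'v set"
  where "admissible bracket scale_v act \<omega> =
    {v. \<exists>\<xi>\<in>ham bracket scale_v act \<omega>.
          ce_diff bracket scale_v act (cochain0 v) = insertion \<xi> \<omega>}"

(* The invariants V^g for the action X.v = zeta(X).v. *)
definition invariants :: "('h \<Rightarrow> 'v::zero \<Rightarrow> 'v) \<Rightarrow> ('g \<Rightarrow> 'h) \<Rightarrow> 'v set"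
  where "invariants act \<zeta> = {v. \<forall>X. act (\<zeta> X) v = 0}"

(* Continuity into V_omega with its subspace topology is continuity into V. *)
definition momentum_map ::
  "('k::real_normed_field \<Rightarrow> 'g::topological_ab_group_add \<Rightarrow> 'g) \<Rightarrow> ('h \<Rightarrow> 'h \<Rightarrow> 'h) \<Rightarrow>
   ('k \<Rightarrow> 'v::topological_ab_group_add \<Rightarrow> 'v) \<Rightarrow> ('h \<Rightarrow> 'v \<Rightarrow> 'v) \<Rightarrow> ('h list \<Rightarrow> 'v) \<Rightarrow>
   ('g \<Rightarrow> 'h) \<Rightarrow> ('g \<Rightarrow> 'v) \<Rightarrow> bool"
  where "momentum_map scale_g bracket_h scale_v act \<omega> \<zeta> J \<longleftrightarrow>
    Vector_Spaces.linear scale_g scale_v J \<and> continuous_on UNIV J \<and>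
    (\<forall>X. J X \<in> admissible bracket_h scale_v act \<omega>) \<and>
    (\<forall>X. ce_diff bracket_h scale_v act (cochain0 (J X)) = insertion (\<zeta> X) \<omega>)"

context topological_lie_module
begin

lemma act_zero_right: "act \<xi> 0 = 0"
proof -
  interpret l: Vector_Spaces.linear scale_v scale_v "\<lambda>v. act \<xi> v" by (rule linear_act_right)
  show ?thesis by (rule l.zero)
qed

lemma ce_diff_cochain0:
  "ce_diff bracket scale_v act (cochain0 v) xs = (case xs of [\<xi>] \<Rightarrow> act \<xi> v | _ \<Rightarrow> 0)"
  by (auto simp: ce_diff_def cochain0_def delete_nth_def act_zero_right
      split: list.split intro!: sum.neutral)

lemma ce_diff_2:
  "ce_diff bracket scale_v act \<omega> [x, y, z] =
     act x (\<omega> [y, z]) - act y (\<omega> [x, z]) + act z (\<omega> [x, y])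
     - \<omega> [bracket x y, z] + \<omega> [bracket x z, y] - \<omega> [bracket y z, x]"
  by (simp add: ce_diff_def delete_nth_def eval_nat_numeral lessThan_Suc algebra_simps)

end

end

theory Submission
  imports Defs
begin

text \<open>
  With \<open>\<omega>\<close> read as a symplectic form, an equation \<open>i\<^sub>\<xi> \<omega> = d v\<close> says that \<open>\<xi>\<close> is a Hamiltonian
  vector field of \<open>v\<close>, and the result is Noether's theorem: the flow of an invariant Hamiltonian
  conserves the momentum map. The reason is that the rate of change \<open>\<xi>.J(X)\<close> and the infinitesimal
  symmetry \<open>\<zeta>(X).v\<close> are the same element of \<open>V\<close> up to sign, namely the Poisson bracket of the two
  Hamiltonians \<open>v\<close> and \<open>J(X)\<close>:
  \<open>\<xi>.J(X) = \<omega>(\<zeta>(X), \<xi>) = - \<omega>(\<xi>, \<zeta>(X)) = - \<zeta>(X).v = 0\<close>.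
  The first and third equalities are the defining equations of the two Hamiltonians, evaluated at
  one vector (\<open>hamiltonian_apply\<close>); the second is the antisymmetry of 2-cochains
  (\<open>ce_cochains_2_antisym\<close>), and the last is the invariance of \<open>v\<close>.
\<close>

text \<open>
  Cochains are alternating in the sense of vanishing on repeated arguments; antisymmetry follows by
  polarisation, expanding \<open>\<omega>(x + y, x + y) = 0\<close>.
\<close>
lemma ce_cochains_2_antisym:
  assumes "\<omega> \<in> ce_cochains scale_h scale_v 2"
  shows "\<omega> [x, y] = - \<omega> [y, x]"
proof -
  have lin: "Vector_Spaces.linear scale_h scale_v (\<lambda>\<xi>. \<omega> (xs[i := \<xi>]))"
    if "length xs = 2" "i < 2" for xs i
    using assms that by (auto simp: ce_cochains_def)
  have alt: "\<omega> [a, a] = 0" for a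
    using assms by (auto simp: ce_cochains_def)
  have add_left: "\<omega> [a + b, c] = \<omega> [a, c] + \<omega> [b, c]" for a b c
    using module_hom.add[OF Vector_Spaces.linear.axioms(3)[OF lin[of "[a, c]" 0]]] by simp
  have add_right: "\<omega> [c, a + b] = \<omega> [c, a] + \<omega> [c, b]" for a b c
    using module_hom.add[OF Vector_Spaces.linear.axioms(3)[OF lin[of "[c, a]" 1]]] by simp
  have "\<omega> [x, y] + \<omega> [y, x] = \<omega> [x + y, x + y]"
    using alt[of x] alt[of y] by (simp add: add_left add_right)
  then show ?thesis
    by (simp add: alt eq_neg_iff_add_eq_0)
qed

lemma (in topological_lie_module) hamiltonian_apply:
  assumes "insertion \<xi> \<omega> = ce_diff bracket scale_v act (cochain0 v)"
  shows "act \<eta> v = \<omega> [\<xi>, \<eta>]"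
  using fun_cong[OF assms, of "[\<eta>]"] by (simp add: insertion_def ce_diff_cochain0)

theorem proposition5p1:
  fixes scale_h :: "'k::real_normed_field \<Rightarrow> 'h::topological_ab_group_add \<Rightarrow> 'h"
    and scale_g :: "'k \<Rightarrow> 'g::topological_ab_group_add \<Rightarrow> 'g"
    and scale_v :: "'k \<Rightarrow> 'v::topological_ab_group_add \<Rightarrow> 'v"
    and bracket_h :: "'h \<Rightarrow> 'h \<Rightarrow> 'h"
    and bracket_g :: "'g \<Rightarrow> 'g \<Rightarrow> 'g"
    and act :: "'h \<Rightarrow> 'v \<Rightarrow> 'v"
    and \<omega> :: "'h list \<Rightarrow> 'v"
    and \<zeta> :: "'g \<Rightarrow> 'h"
    and J :: "'g \<Rightarrow> 'v"
    and \<xi> :: 'h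
  assumes "topological_lie_algebra scale_h bracket_h"
    and "topological_lie_algebra scale_g bracket_g"
    and "topological_lie_module scale_h bracket_h scale_v act"
    and "\<omega> \<in> ce_cocycles scale_h bracket_h scale_v act 2"
    and "continuous_lie_hom scale_g bracket_g scale_h bracket_h \<zeta>"
    and "\<forall>X. \<zeta> X \<in> ham bracket_h scale_v act \<omega>"
    and "momentum_map scale_g bracket_h scale_v act \<omega> \<zeta> J"
    and "\<xi> \<in> ham bracket_h scale_v act \<omega>"
    and "\<exists>v\<in>invariants act \<zeta>. insertion \<xi> \<omega> = ce_diff bracket_h scale_v act (cochain0 v)"
  shows "\<forall>X. act \<xi> (J X) = 0"
proof
  fix X
  interpret topological_lie_module scale_h bracket_h scale_v act
    by (rule assms(3))
  obtain v where inv: "act (\<zeta> X) v = 0"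
    and v: "insertion \<xi> \<omega> = ce_diff bracket_h scale_v act (cochain0 v)"
    using assms(9) by (auto simp: invariants_def)
  have J: "insertion (\<zeta> X) \<omega> = ce_diff bracket_h scale_v act (cochain0 (J X))"
    using assms(7) by (simp add: momentum_map_def)
  have "\<omega> \<in> ce_cochains scale_h scale_v 2"
    using assms(4) by (simp add: ce_cocycles_def)
  have "act \<xi> (J X) = \<omega> [\<zeta> X, \<xi>]"
    by (rule hamiltonian_apply[OF J])
  also have "\<dots> = - \<omega> [\<xi>, \<zeta> X]"
    by (rule ce_cochains_2_antisym) fact
  also have "\<dots> = - act (\<zeta> X) v"
    by (simp add: hamiltonian_apply[OF v])
  finally show "act \<xi> (J X) = 0"
    by (simp add: inv)
qed

end
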